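(* The monoid $\mathrm{Styl}(A)$ is $J$-trivial: for all $u,v\in\mathrm{Styl}(A)$, if $\mathrm{Styl}(A)\,u\,\mathrm{Styl}(A)=\mathrm{Styl}(A)\,v\,\mathrm{Styl}(A)$ then $u=v$.
   Context: $A$ is a finite totally ordered alphabet and $A^*$ the free monoid on $A$. A column is a subset of $A$, identified with the strictly decreasing word of its elements. For a column $\gamma$ and a letter $x$: if $x>y$ for all $y\in\gamma$, let $x\cdot\gamma=\gamma\cup\{x\}$; otherwise let $y$ be the smallest element of $\gamma$ with $y\geq x$ and let $x\cdot\gamma=(\gamma\setminus\{y\})\cup\{x\}$. This extends to a left action of $A^*$ on the set of columns by $(uv)\cdot\gamma=u\cdot(v\cdot\gamma)$. $\mathrm{Styl}(A)$ is the monoid of maps of the set of columns to itself induced by words under this action. *)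

theory Defs
  imports "HOL-Algebra.Coset"
begin

text \<open>A column over the alphabet \<open>A\<close> is a subset of \<open>A\<close>, so the set of columns is \<open>Pow A\<close>.\<close>

definition insert_letter :: "'a::linorder \<Rightarrow> 'a set \<Rightarrow> 'a set" where
  "insert_letter x \<gamma> =
     (if \<forall>y\<in>\<gamma>. y < x then \<gamma> \<union> {x} else (\<gamma> - {Min {y \<in> \<gamma>. x \<le> y}}) \<union> {x})"

text \<open>Left action of words: the last letter acts first.\<close>

definition act :: "'a::linorder list \<Rightarrow> 'a set \<Rightarrow> 'a set" where
  "act w \<gamma> = foldr insert_letter w \<gamma>"

lemma act_Nil: "act [] \<gamma> = \<gamma>"
  by (simp add: act_def)

lemma act_single: "act [x] \<gamma> = insert_letter x \<gamma>"
  by (simp add: act_def)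

lemma act_append: "act (u @ v) \<gamma> = act u (act v \<gamma>)"
  by (simp add: act_def)

lemma act_closed:
  assumes "w \<in> lists A" "\<gamma> \<in> Pow A"
  shows "act w \<gamma> \<in> Pow A"
  using assms by (induction w) (auto simp: act_def insert_letter_def split: if_splits)

text \<open>Maps of \<open>Pow A\<close> to itself are represented by functions that are \<open>undefined\<close> outside \<open>Pow A\<close>,
  so that equality of elements is equality of maps on columns.\<close>

definition Styl :: "'a::linorder set \<Rightarrow> ('a set \<Rightarrow> 'a set) monoid" where
  "Styl A = \<lparr>carrier = {restrict (act w) (Pow A) | w. w \<in> lists A},
             mult = compose (Pow A),
             one = restrict id (Pow A)\<rparr>"

lemma Styl_mult_act:
  assumes "v \<in> lists A"
  shows "restrict (act u) (Pow A) \<otimes>\<^bsub>Styl A\<^esub> restrict (act v) (Pow A) =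
           restrict (act (u @ v)) (Pow A)"
  using act_closed[OF assms]
  by (auto simp: Styl_def compose_def act_append fun_eq_iff restrict_def)

lemma Styl_one_act: "\<one>\<^bsub>Styl A\<^esub> = restrict (act []) (Pow A)"
  by (auto simp: Styl_def act_Nil fun_eq_iff restrict_def)

lemma monoid_Styl: "monoid (Styl A)"
proof -
  let ?r = "\<lambda>w. restrict (act w) (Pow A)"
  have car: "carrier (Styl A) = ?r ` lists A"
    by (auto simp: Styl_def)
  have mult: "?r u \<otimes>\<^bsub>Styl A\<^esub> ?r v = ?r (u @ v)" if "v \<in> lists A" for u v
    using that by (rule Styl_mult_act)
  show ?thesis
  proof
    fix f g assume "f \<in> carrier (Styl A)" "g \<in> carrier (Styl A)"
    then obtain u v where w: "u \<in> lists A" "v \<in> lists A" "f = ?r u" "g = ?r v"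
      unfolding car by blast
    have "f \<otimes>\<^bsub>Styl A\<^esub> g = ?r (u @ v)"
      using w mult by simp
    moreover have "u @ v \<in> lists A"
      using w by simp
    ultimately show "f \<otimes>\<^bsub>Styl A\<^esub> g \<in> carrier (Styl A)"
      unfolding car by blast
  next
    fix f g h
    assume "f \<in> carrier (Styl A)" "g \<in> carrier (Styl A)" "h \<in> carrier (Styl A)"
    then obtain u v w where w: "u \<in> lists A" "v \<in> lists A" "w \<in> lists A"
      "f = ?r u" "g = ?r v" "h = ?r w"
      unfolding car by blast
    then have "v @ w \<in> lists A"
      by simp
    with w show "f \<otimes>\<^bsub>Styl A\<^esub> g \<otimes>\<^bsub>Styl A\<^esub> h = f \<otimes>\<^bsub>Styl A\<^esub> (g \<otimes>\<^bsub>Styl A\<^esub> h)"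
      by (simp only: mult append_assoc)
  next
    show "\<one>\<^bsub>Styl A\<^esub> \<in> carrier (Styl A)"
      unfolding car Styl_one_act by blast
  next
    fix f assume "f \<in> carrier (Styl A)"
    then obtain u where w: "u \<in> lists A" "f = ?r u"
      unfolding car by blast
    then show "\<one>\<^bsub>Styl A\<^esub> \<otimes>\<^bsub>Styl A\<^esub> f = f"
      by (simp only: Styl_one_act mult append_Nil)
    from w show "f \<otimes>\<^bsub>Styl A\<^esub> \<one>\<^bsub>Styl A\<^esub> = f"
      by (simp only: Styl_one_act mult lists.Nil append_Nil2)
  qed
qed

text \<open>For a monoid \<open>M\<close>, \<open>(carrier M #> u) <#> carrier M\<close> is the principal two-sided ideal \<open>M u M\<close>.\<close>

definition J_trivial :: "('a, 'b) monoid_scheme \<Rightarrow> bool" where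
  "J_trivial M \<longleftrightarrow>
     (\<forall>u \<in> carrier M. \<forall>v \<in> carrier M.
        (carrier M #>\<^bsub>M\<^esub> u) <#>\<^bsub>M\<^esub> carrier M = (carrier M #>\<^bsub>M\<^esub> v) <#>\<^bsub>M\<^esub> carrier M \<longrightarrow> u = v)"

end

theory Submission
  imports Defs
begin

text \<open>Order columns by \<open>\<gamma> \<preceq> \<delta>\<close> iff \<open>\<gamma>\<close> has at most as many elements \<open>\<le> t\<close> as \<open>\<delta>\<close>, for every \<open>t\<close>. Inserting
  \<open>x\<close> leaves the number of elements \<open>\<le> t\<close> unchanged for \<open>t < x\<close>, and for \<open>t \<ge> x\<close> replaces it by its
  maximum with \<open>1\<close> plus the number of elements \<open>< x\<close>. So every word acts by an increasing and
  order-preserving map, and if \<open>u = p v q\<close> then \<open>u(\<gamma>) = p(v(q(\<gamma>))) \<succeq> v(q(\<gamma>)) \<succeq> v(\<gamma>)\<close>; by symmetry and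
  antisymmetry \<open>u = v\<close>.\<close>

definition rank_le :: "'a::linorder set \<Rightarrow> 'a \<Rightarrow> nat" where
  "rank_le \<gamma> t = card {y \<in> \<gamma>. y \<le> t}"

definition rank_less :: "'a::linorder set \<Rightarrow> 'a \<Rightarrow> nat" where
  "rank_less \<gamma> t = card {y \<in> \<gamma>. y < t}"

definition column_le :: "'a::linorder set \<Rightarrow> 'a set \<Rightarrow> bool" (infix \<open>\<preceq>\<close> 50) where
  "\<gamma> \<preceq> \<delta> \<longleftrightarrow> (\<forall>t. rank_le \<gamma> t \<le> rank_le \<delta> t)"

lemma column_le_refl: "\<gamma> \<preceq> \<gamma>"
  by (simp add: column_le_def)

lemma column_le_trans: "\<lbrakk>\<gamma> \<preceq> \<delta>; \<delta> \<preceq> \<epsilon>\<rbrakk> \<Longrightarrow> \<gamma> \<preceq> \<epsilon>"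
  unfolding column_le_def by (meson order_trans)

text \<open>The two counts at \<open>t\<close> differ exactly when \<open>t\<close> is in the
  column, so together they determine membership; antisymmetry rests on this.\<close>

lemma rank_le_eq_rank_less:
  assumes "finite \<gamma>"
  shows "rank_le \<gamma> t = rank_less \<gamma> t + (if t \<in> \<gamma> then 1 else 0)"
proof (cases "t \<in> \<gamma>")
  case True
  then have "{y \<in> \<gamma>. y \<le> t} = insert t {y \<in> \<gamma>. y < t}"
    by auto
  with True assms show ?thesis
    by (simp add: rank_le_def rank_less_def)
next
  case False
  then have "{y \<in> \<gamma>. y \<le> t} = {y \<in> \<gamma>. y < t}"
    by (auto simp: order.order_iff_strict)
  with False show ?thesis
    by (simp add: rank_le_def rank_less_def)
qed

text \<open>Since \<open>x\<close> may have no predecessor in the order, the strict count is reduced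
  to a non-strict one at the largest element of \<open>\<gamma>\<close> below \<open>x\<close>,
  where \<open>\<preceq>\<close> applies.\<close>

lemma rank_less_mono:
  assumes "finite \<gamma>" "finite \<delta>" "\<gamma> \<preceq> \<delta>"
  shows "rank_less \<gamma> x \<le> rank_less \<delta> x"
proof (cases "{y \<in> \<gamma>. y < x} = {}")
  case True
  then show ?thesis
    by (simp only: rank_less_def card.empty le0)
next
  case False
  define m where "m = Max {y \<in> \<gamma>. y < x}"
  have m: "m < x"
    using Max_in[OF _ False] assms(1) by (simp add: m_def)
  have "{y \<in> \<gamma>. y < x} \<subseteq> {y \<in> \<gamma>. y \<le> m}"
    using assms(1) by (auto simp: m_def)
  then have "rank_less \<gamma> x \<le> rank_le \<gamma> m"
    unfolding rank_less_def rank_le_def using assms(1) by (intro card_mono) auto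
  also have "\<dots> \<le> rank_le \<delta> m"
    using assms(3) by (simp add: column_le_def)
  also have "\<dots> \<le> rank_less \<delta> x"
    unfolding rank_less_def rank_le_def using assms(2) m by (intro card_mono) auto
  finally show ?thesis .
qed

lemma column_le_antisym:
  assumes "finite \<gamma>" "finite \<delta>" "\<gamma> \<preceq> \<delta>" "\<delta> \<preceq> \<gamma>"
  shows "\<gamma> = \<delta>"
proof -
  have "x \<in> \<gamma> \<longleftrightarrow> x \<in> \<delta>" for x
  proof -
    have "rank_less \<gamma> x = rank_less \<delta> x"
      using assms by (simp add: rank_less_mono order_antisym)
    moreover have "rank_le \<gamma> x = rank_le \<delta> x"
      using assms(3,4) by (simp add: column_le_def order_antisym)
    ultimately show ?thesis
      using rank_le_eq_rank_less[OF assms(1), of x] rank_le_eq_rank_less[OF assms(2), of x]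
      by (auto split: if_splits)
  qed
  then show ?thesis
    by blast
qed

text \<open>The \<open>max\<close> unifies two situations for \<open>t \<ge> x\<close>: if
  \<open>\<gamma>\<close> has an element between \<open>x\<close> and \<open>t\<close>, the
  displaced letter is also \<open>\<le> t\<close> and the count stays; otherwise the old count is
  \<open>rank_less \<gamma> x\<close> and grows by one.\<close>

lemma rank_le_insert_letter:
  assumes fin: "finite \<gamma>"
  shows "rank_le (insert_letter x \<gamma>) t =
           (if t < x then rank_le \<gamma> t else max (rank_le \<gamma> t) (Suc (rank_less \<gamma> x)))"
proof (cases "\<forall>y\<in>\<gamma>. y < x")
  case True
  then have ins: "insert_letter x \<gamma> = insert x \<gamma>"
    by (simp add: insert_letter_def)
  show ?thesis
  proof (cases "t < x")
    case True
    then have "{y \<in> insert x \<gamma>. y \<le> t} = {y \<in> \<gamma>. y \<le> t}"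
      by auto
    then show ?thesis
      using True by (simp add: ins rank_le_def)
  next
    case False
    then have "{y \<in> insert x \<gamma>. y \<le> t} = insert x \<gamma>" "{y \<in> \<gamma>. y \<le> t} = \<gamma>" "{y \<in> \<gamma>. y < x} = \<gamma>"
      using True by fastforce+
    moreover have "x \<notin> \<gamma>"
      using True by blast
    ultimately show ?thesis
      using False fin by (simp add: ins rank_le_def rank_less_def)
  qed
next
  case nonmax: False
  define m where "m = Min {y \<in> \<gamma>. x \<le> y}"
  have ne: "{y \<in> \<gamma>. x \<le> y} \<noteq> {}"
    using nonmax by (auto simp: not_less)
  have m: "m \<in> \<gamma>" "x \<le> m"
    using Min_in[OF _ ne] fin by (auto simp: m_def)
  have m_le: "m \<le> y" if "y \<in> \<gamma>" "x \<le> y" for y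
    using that fin by (simp add: m_def)
  have ins: "insert_letter x \<gamma> = insert x (\<gamma> - {m})"
    unfolding insert_letter_def m_def[symmetric] if_not_P[OF nonmax] by simp
  \<comment> \<open>The counts below \<open>x\<close> see neither letter, those from
    \<open>x\<close> up to just below \<open>m\<close> gain \<open>x\<close>, and from
    \<open>m\<close> on the gain of \<open>x\<close> and the loss of \<open>m\<close>
    cancel.\<close>
  consider "t < x" | "x \<le> t" "t < m" | "m \<le> t"
    by (metis not_less)
  then show ?thesis
  proof cases
    case 1
    then have "{y \<in> insert x (\<gamma> - {m}). y \<le> t} = {y \<in> \<gamma>. y \<le> t}"
      using m by auto
    with 1 show ?thesis
      by (simp add: ins rank_le_def)
  next
    case 2
    have "{y \<in> insert x (\<gamma> - {m}). y \<le> t} = insert x {y \<in> \<gamma>. y < x}"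
      and "{y \<in> \<gamma>. y \<le> t} = {y \<in> \<gamma>. y < x}"
      using 2 m m_le by (fastforce simp: not_le)+
    with 2 fin show ?thesis
      by (simp add: ins rank_le_def rank_less_def not_less)
  next
    case 3
    \<comment> \<open>If \<open>x\<close> is already in \<open>\<gamma>\<close>, minimality forces
      \<open>m = x\<close>, so adding \<open>x\<close> after deleting \<open>m\<close> always raises
      the cardinality by one.\<close>
    have "x \<notin> \<gamma> - {m}"
      using m m_le[of x] by auto
    moreover have "{y \<in> insert x (\<gamma> - {m}). y \<le> t} = insert x ({y \<in> \<gamma>. y \<le> t} - {m})"
      using 3 m by auto
    moreover have "Suc (card ({y \<in> \<gamma>. y \<le> t} - {m})) = card {y \<in> \<gamma>. y \<le> t}"
      using fin m 3 by (intro card_Suc_Diff1) auto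
    ultimately have "rank_le (insert_letter x \<gamma>) t = rank_le \<gamma> t"
      using fin by (simp add: ins rank_le_def)
    \<comment> \<open>The letter \<open>m\<close> supplies the extra element that makes the old
      count the larger argument of the \<open>max\<close>.\<close>
    moreover have "insert m {y \<in> \<gamma>. y < x} \<subseteq> {y \<in> \<gamma>. y \<le> t}"
      using 3 m by auto
    then have "card (insert m {y \<in> \<gamma>. y < x}) \<le> rank_le \<gamma> t"
      unfolding rank_le_def using fin by (intro card_mono) auto
    then have "Suc (rank_less \<gamma> x) \<le> rank_le \<gamma> t"
      using fin m by (simp add: rank_less_def not_less)
    ultimately show ?thesis
      using 3 m by auto
  qed
qed

lemma column_le_insert_letter: "finite \<gamma> \<Longrightarrow> \<gamma> \<preceq> insert_letter x \<gamma>"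
  by (simp add: column_le_def rank_le_insert_letter)

text \<open>The new rank depends on the column only through \<open>rank_le\<close> at
  \<open>t\<close> and \<open>rank_less\<close> at \<open>x\<close>, and is nondecreasing in
  both.\<close>

lemma insert_letter_mono:
  assumes "finite \<gamma>" "finite \<delta>" "\<gamma> \<preceq> \<delta>"
  shows "insert_letter x \<gamma> \<preceq> insert_letter x \<delta>"
  using assms(3) rank_less_mono[OF assms, of x]
  by (auto simp: column_le_def rank_le_insert_letter assms(1,2) intro: max.coboundedI1 max.coboundedI2)

lemma act_Cons: "act (x # w) \<gamma> = insert_letter x (act w \<gamma>)"
  by (simp add: act_def)

lemma finite_act: "finite \<gamma> \<Longrightarrow> finite (act w \<gamma>)"
  by (induction w) (auto simp: act_Nil act_Cons insert_letter_def)

lemma column_le_act: "finite \<gamma> \<Longrightarrow> \<gamma> \<preceq> act w \<gamma>"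
  by (induction w)
     (auto simp: act_Nil act_Cons
       intro: column_le_refl column_le_trans[OF _ column_le_insert_letter] finite_act)

lemma act_mono:
  assumes "finite \<gamma>" "finite \<delta>" "\<gamma> \<preceq> \<delta>"
  shows "act w \<gamma> \<preceq> act w \<delta>"
  using assms by (induction w) (simp_all add: act_Nil act_Cons insert_letter_mono finite_act)

lemma act_le_act_infix:
  assumes "finite \<gamma>"
  shows "act v \<gamma> \<preceq> act (p @ v @ q) \<gamma>"
  unfolding act_append using assms
  by (meson act_mono column_le_act column_le_trans finite_act)

lemma principal_ideal_eq:
  "(carrier M #>\<^bsub>M\<^esub> u) <#>\<^bsub>M\<^esub> carrier M =
     {(p \<otimes>\<^bsub>M\<^esub> u) \<otimes>\<^bsub>M\<^esub> q | p q. p \<in> carrier M \<and> q \<in> carrier M}"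
  by (auto simp: r_coset_def set_mult_def)

lemma Styl_carrier_cases:
  assumes "f \<in> carrier (Styl A)"
  obtains w where "w \<in> lists A" "f = restrict (act w) (Pow A)"
  using assms by (auto simp: Styl_def)

lemma principal_ideal_Styl_le:
  assumes "finite A" "v \<in> carrier (Styl A)"
    and ideal: "u \<in> (carrier (Styl A) #>\<^bsub>Styl A\<^esub> v) <#>\<^bsub>Styl A\<^esub> carrier (Styl A)"
    and \<gamma>: "\<gamma> \<in> Pow A"
  shows "v \<gamma> \<preceq> u \<gamma>"
proof -
  obtain p q where pq: "p \<in> carrier (Styl A)" "q \<in> carrier (Styl A)"
    "u = p \<otimes>\<^bsub>Styl A\<^esub> v \<otimes>\<^bsub>Styl A\<^esub> q"
    using ideal unfolding principal_ideal_eq by blast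
  obtain a b c where w: "b \<in> lists A" "c \<in> lists A"
    "p = restrict (act a) (Pow A)" "v = restrict (act b) (Pow A)" "q = restrict (act c) (Pow A)"
    using pq(1,2) assms(2) by (metis Styl_carrier_cases)
  have "u = restrict (act (a @ b @ c)) (Pow A)"
    using w pq(3) by (simp add: Styl_mult_act)
  moreover have "finite \<gamma>"
    using \<gamma> assms(1) by (auto intro: finite_subset)
  ultimately show ?thesis
    using \<gamma> w(4) by (simp add: act_le_act_infix)
qed

theorem theorem11p1:
  fixes A :: "'a::linorder set"
  assumes "finite A"
  shows "J_trivial (Styl A)"
  unfolding J_trivial_def
proof (intro ballI impI)
  interpret monoid "Styl A"
    by (rule monoid_Styl)
  fix u v
  let ?ideal = "\<lambda>f. (carrier (Styl A) #>\<^bsub>Styl A\<^esub> f) <#>\<^bsub>Styl A\<^esub> carrier (Styl A)"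
  assume uv: "u \<in> carrier (Styl A)" "v \<in> carrier (Styl A)" and eq: "?ideal u = ?ideal v"
  \<comment> \<open>Writing \<open>f\<close> as \<open>1 f 1\<close> puts it in its own ideal, so
    equal ideals place each of \<open>u\<close>, \<open>v\<close> in the ideal of the other.\<close>
  have self: "f \<in> ?ideal f" if "f \<in> carrier (Styl A)" for f
    unfolding principal_ideal_eq using that by (auto intro!: exI[of _ "\<one>\<^bsub>Styl A\<^esub>"])
  obtain a b where w: "a \<in> lists A" "b \<in> lists A"
    "u = restrict (act a) (Pow A)" "v = restrict (act b) (Pow A)"
    using uv by (metis Styl_carrier_cases)
  have "u \<gamma> = v \<gamma>" if \<gamma>: "\<gamma> \<in> Pow A" for \<gamma>
  proof (rule column_le_antisym)
    have "finite \<gamma>"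
      using \<gamma> assms by (auto intro: finite_subset)
    then show "finite (u \<gamma>)" "finite (v \<gamma>)"
      using w \<gamma> by (simp_all add: finite_act)
    show "u \<gamma> \<preceq> v \<gamma>" "v \<gamma> \<preceq> u \<gamma>"
      using principal_ideal_Styl_le[OF assms _ _ \<gamma>] uv eq self by metis+
  qed
  \<comment> \<open>Both maps are \<open>undefined\<close> outside \<open>Pow A\<close>, so
    agreement on columns is enough.\<close>
  then show "u = v"
    unfolding w(3,4) by (intro restrict_ext) simp
qed

end
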